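(* For all integers $L\ge 1$ and $0\le n\le L-1$, the restricted partition function for $p=1$ and $q=0$ is the Stirling number of the second kind: $$\begin{Bmatrix}L\\ n+1\end{Bmatrix}_{1,0}=\begin{Bmatrix}L\\ n+1\end{Bmatrix}.$$
   Context: $\Omega_{L,n}$ is the set of words $\tau=(\tau_1,\dots,\tau_L)$ with letters in $\{0,1,\hat 1\}$ containing exactly one $\hat 1$, exactly $n$ letters $1$ and $L-n-1$ letters $0$. For $\tau\in\Omega_{L,n}$ with $\tau_1=\hat 1$ set $$w(\tau)=\prod_{\substack{2\le i\le L\\ \tau_i=0}}\bigl(1+p\,m_i(\tau)+q\,n_i(\tau)\bigr),$$ where $m_i(\tau)$ (resp. $n_i(\tau)$) is the number of $1$'s among $\tau_2,\dots,\tau_{i-1}$ (resp. among $\tau_{i+1},\dots,\tau_L$). The restricted partition function is $$\begin{Bmatrix}L\\ n+1\end{Bmatrix}_{p,q}=\sum_{\tau\in\Omega_{L,n},\ \tau_1=\hat 1}w(\tau).$$ $\begin{Bmatrix}m\\ k\end{Bmatrix}$ (without subscripts) is the Stirling number of the second kind, the number of set partitions of $\{1,\dots,m\}$ into exactly $k$ nonempty parts. *)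

theory Defs
  imports Main "HOL-Library.Disjoint_Sets"
begin

datatype letter = Zero | One | Hat

text \<open>
  Words are lists, so the letter $\tau_i$ of the mathematical text is \<open>\<tau> ! (i - 1)\<close>.
  Positions below are 0-based: position \<open>0\<close> is $\tau_1$, and the range
  $2 \le i \le L$ becomes \<open>{1..<length \<tau>}\<close>.
\<close>

definition Omega :: "nat \<Rightarrow> nat \<Rightarrow> letter list set" where
  "Omega L n = {\<tau>. length \<tau> = L \<and> count_list \<tau> Hat = 1 \<and> count_list \<tau> One = n
                    \<and> count_list \<tau> Zero = L - n - 1}"

definition ones_before :: "letter list \<Rightarrow> nat \<Rightarrow> nat" where
  "ones_before \<tau> i = card {j \<in> {1..<i}. \<tau> ! j = One}"

definition ones_after :: "letter list \<Rightarrow> nat \<Rightarrow> nat" where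
  "ones_after \<tau> i = card {j \<in> {i<..<length \<tau>}. \<tau> ! j = One}"

definition weight :: "'a::comm_semiring_1 \<Rightarrow> 'a \<Rightarrow> letter list \<Rightarrow> 'a" where
  "weight p q \<tau> =
     (\<Prod>i \<in> {i \<in> {1..<length \<tau>}. \<tau> ! i = Zero}.
        1 + p * of_nat (ones_before \<tau> i) + q * of_nat (ones_after \<tau> i))"

text \<open>
  The restricted partition function written $\{L \atop n+1\}_{p,q}$. The arguments are
  \<open>L\<close> and \<open>n\<close>, so the lower entry of the brace symbol is \<open>n + 1\<close>.
\<close>
definition restricted_partition_function ::
    "'a::comm_semiring_1 \<Rightarrow> 'a \<Rightarrow> nat \<Rightarrow> nat \<Rightarrow> 'a" where
  "restricted_partition_function p q L n =
     (\<Sum>\<tau> \<in> {\<tau> \<in> Omega L n. \<tau> ! 0 = Hat}. weight p q \<tau>)"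

text \<open>
  The Stirling number of the second kind as a count of set partitions; the blocks of a
  \<^const>\<open>partition_on\<close> are nonempty. The constant \<open>Stirling\<close> of
  \<open>HOL-Combinatorics\<close> is instead defined by the recurrence.
\<close>
definition stirling2 :: "nat \<Rightarrow> nat \<Rightarrow> nat" where
  "stirling2 m k = card {P. partition_on {1..m} P \<and> card P = k}"

end

theory Submission
  imports Defs "HOL-Combinatorics.Stirling"
begin

text \<open>
  Both sides satisfy the recurrence
  $S(L+1, n+1) = (n+1)\, S(L, n+1) + S(L, n)$.
  For set partitions, the last element either forms a block of its own or joins one of the
  $n+1$ blocks of a partition of the others. For words, a final letter \<open>One\<close> contributes no
  factor and, since $q = 0$, changes no other factor, while a final letter \<open>Zero\<close> contributes
  the factor $1 + n$.
\<close>

section \<open>Counting set partitions\<close>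

text \<open>Taking \<open>B\<close> out of \<open>P\<close> leaves a partition of
  \<open>A - B\<close>. This is the same set as \<open>insert x A - insert x B\<close>, so
  \<open>insert x B\<close> can be put back as a block in place of \<open>B\<close>.\<close>

lemma partition_on_grow_block:
  assumes "x \<notin> A" "partition_on A P" "B \<in> P"
  shows "partition_on (insert x A) (insert (insert x B) (P - {B}))"
proof -
  have disj: "disjnt B (\<Union>(P - {B}))"
    using assms by (auto simp: partition_on_def disjoint_def disjnt_iff)
  have P: "insert B (P - {B}) = P"
    using assms by blast
  have "partition_on (A - B) (P - {B})" "B \<subseteq> A"
    using partition_on_insert[OF disj, of A] assms P by simp_all
  moreover have "insert x A - insert x B = A - B"
    using \<open>x \<notin> A\<close> by blast
  moreover have "disjnt (insert x B) (\<Union>(P - {B}))"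
    using disj assms by (auto simp: disjnt_iff partition_on_def)
  ultimately show ?thesis
    by (simp add: partition_on_insert subset_insertI2)
qed

text \<open>Inverse of growing a block: the other blocks partition what lies outside
  \<open>C\<close>, and \<open>C \<noteq> {x}\<close> keeps the shrunken block nonempty.\<close>

lemma partition_on_shrink_block:
  assumes "x \<notin> A" "partition_on (insert x A) Q" "x \<in> C" "C \<in> Q" "C \<noteq> {x}"
  shows "partition_on A (insert (C - {x}) (Q - {C}))"
proof -
  have disj: "disjnt C (\<Union>(Q - {C}))"
    using assms by (auto simp: partition_on_def disjoint_def disjnt_iff)
  have Q: "insert C (Q - {C}) = Q"
    using assms by blast
  have "partition_on (insert x A - C) (Q - {C})" "C \<subseteq> insert x A"
    using partition_on_insert[OF disj, of "insert x A"] assms Q by simp_all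
  moreover have "insert x A - C = A - (C - {x})"
    using assms by blast
  moreover have "disjnt (C - {x}) (\<Union>(Q - {C}))"
    using disj by (auto simp: disjnt_iff)
  moreover have "C - {x} \<noteq> {}"
    using assms by blast
  ultimately show ?thesis
    by (auto simp: partition_on_insert)
qed

text \<open>The conjunct \<open>{x} \<notin> P\<close> excludes the case where \<open>P\<close>
  already has the block \<open>{x}\<close> and the insertion changes nothing. If \<open>x\<close>
  lies in some block of \<open>P\<close>, both sides fail: that block would have to be
  \<open>{x}\<close> on the left, and \<open>x \<notin> A\<close> on the right.\<close>

lemma partition_on_insert_singleton:
  assumes "x \<notin> A"
  shows "partition_on (insert x A) (insert {x} P) \<and> {x} \<notin> P \<longleftrightarrow> partition_on A P"
proof (cases "x \<in> \<Union>P")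
  case True
  then have "\<not> partition_on A P"
    using assms by (auto simp: partition_on_def)
  moreover have "{x} \<in> P" if "partition_on (insert x A) (insert {x} P)"
    using that True by (auto simp: partition_on_def disjoint_def)
  ultimately show ?thesis by blast
next
  case False
  then show ?thesis
    using assms by (subst partition_on_insert) (auto simp: disjnt_iff)
qed

text \<open>The partitions \<open>Q\<close> with block \<open>{x}\<close> correspond to
  \<open>?F\<close> by deleting that block. The others correspond to pairs of a partition
  \<open>P\<close> in \<open>?E\<close> and the block \<open>B\<close> of \<open>P\<close> that
  \<open>x\<close> joins; there are \<open>Suc k\<close> choices of \<open>B\<close> for each
  \<open>P\<close>.\<close>

lemma card_partition_on_insert:
  assumes "finite A" "x \<notin> A"
  shows "card {Q. partition_on (insert x A) Q \<and> card Q = Suc k} =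
    Suc k * card {P. partition_on A P \<and> card P = Suc k} + card {P. partition_on A P \<and> card P = k}"
    (is "card ?S = _ * card ?E + card ?F")
proof -
  define grow where "grow = (\<lambda>(P, B). insert (insert x B) (P - {B}))"
  have fin: "finite P" if "partition_on A P" for P
    using finite_elements[OF assms(1) that] .
  have fin': "finite Q" if "partition_on (insert x A) Q" for Q
    using finite_elements[OF _ that] assms(1) by simp
  have x_notin: "x \<notin> B" if "partition_on A P" "B \<in> P" for P B
    using that assms(2) by (auto simp: partition_on_def)
  have finE: "finite ?E" and finF: "finite ?F"
    using finitely_many_partition_on[OF assms(1)] by (auto elim: rev_finite_subset)
  have decompose: "Q \<in> insert {x} ` ?F \<union> grow ` Sigma ?E (\<lambda>P. P)" if Q: "Q \<in> ?S" for Q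
  proof -
    have part: "partition_on (insert x A) Q" and card: "card Q = Suc k"
      using Q by auto
    then obtain C where C: "C \<in> Q" "x \<in> C"
      by (auto simp: partition_on_def)
    show ?thesis
    proof (cases "C = {x}")
      case True
      then have "Q = insert {x} (Q - {{x}})"
        using C by blast
      moreover have "partition_on A (Q - {{x}})"
        using partition_on_insert_singleton[OF assms(2), of "Q - {{x}}"] calculation part by auto
      moreover have "card (Q - {{x}}) = k"
        using card True C fin'[OF part] by simp
      ultimately show ?thesis by blast
    next
      case False
      let ?B = "C - {x}"
      let ?P = "insert ?B (Q - {C})"
      have P: "partition_on A ?P"
        using partition_on_shrink_block[OF assms(2) part C(2,1) False] .
      \<comment> \<open>Otherwise removing \<open>x\<close> from \<open>C\<close> would merge two
        blocks and \<open>?P\<close> would have fewer blocks than \<open>Q\<close>. It cannot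
        happen, because distinct blocks are disjoint while \<open>?B\<close> is a nonempty subset of
        \<open>C\<close>.\<close>
      have "?B \<notin> Q"
      proof
        assume "?B \<in> Q"
        moreover have "?B \<noteq> C" "?B \<inter> C = ?B"
          using C by auto
        ultimately have "?B = {}"
          using part C(1) by (auto simp: partition_on_def disjoint_def)
        then show False using C False by blast
      qed
      then have "?P - {?B} = Q - {C}" "card ?P = Suc k"
        using card fin'[OF part] C by (auto simp: card.insert_remove)
      moreover have "insert x ?B = C"
        using C by blast
      ultimately have "grow (?P, ?B) = Q"
        using C by (simp add: grow_def insert_absorb)
      with P \<open>card ?P = Suc k\<close> show ?thesis
        by (intro UnI2 image_eqI[of _ _ "(?P, ?B)"]) auto
    qed
  qed
  have "insert {x} P \<in> ?S" if "P \<in> ?F" for P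
    using that partition_on_insert_singleton[OF assms(2), of P] fin by auto
  then have sub1: "insert {x} ` ?F \<subseteq> ?S"
    by (rule image_subsetI)
  have "grow (P, B) \<in> ?S" if "P \<in> ?E" "B \<in> P" for P B
  proof -
    have P: "partition_on A P" "card P = Suc k"
      using that by auto
    have "insert x B \<notin> P"
      using x_notin[OF P(1)] by blast
    then show ?thesis
      using P fin[OF P(1)] partition_on_grow_block[OF assms(2) P(1) that(2)] that(2)
      by (simp add: grow_def)
  qed
  then have sub2: "grow ` Sigma ?E (\<lambda>P. P) \<subseteq> ?S"
    by (intro image_subsetI) (erule SigmaE, simp only:)
  have S: "?S = insert {x} ` ?F \<union> grow ` Sigma ?E (\<lambda>P. P)"
    using subsetI[OF decompose] Un_least[OF sub1 sub2] by (rule subset_antisym)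
  have inj1: "inj_on (insert {x}) ?F"
  proof (rule inj_onI)
    fix P P' assume "P \<in> ?F" "P' \<in> ?F" "insert {x} P = insert {x} P'"
    moreover have "{x} \<notin> P" "{x} \<notin> P'"
      using calculation(1,2) x_notin by blast+
    ultimately show "P = P'"
      by (simp add: insert_ident)
  qed
  have inj2: "inj_on grow (Sigma ?E (\<lambda>P. P))"
  proof (rule inj_onI, clarify)
    fix P B P' B'
    assume P: "partition_on A P" "B \<in> P" and P': "partition_on A P'" "B' \<in> P'"
      and eq: "grow (P, B) = grow (P', B')"
    \<comment> \<open>No block of \<open>P\<close> or \<open>P'\<close> contains \<open>x\<close>,
      so the enlarged block is the only one containing \<open>x\<close> on either side of
      \<open>eq\<close>; it determines \<open>B\<close>, and the remaining blocks then determine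
      \<open>P\<close>.\<close>
    have notin: "insert x B \<notin> P" "insert x B' \<notin> P'" "insert x B \<notin> P'" "insert x B' \<notin> P"
      using x_notin[OF P(1)] x_notin[OF P'(1)] by blast+
    then have "insert x B = insert x B'"
      using eq by (auto simp: grow_def)
    then have "B = B'"
      using x_notin[OF P] x_notin[OF P'] by (simp add: insert_ident)
    moreover have "P - {B} = P' - {B'}"
      using eq notin \<open>B = B'\<close> by (simp add: grow_def insert_ident)
    ultimately show "P = P' \<and> B = B'"
      using P(2) P'(2) by blast
  qed
  \<comment> \<open>The block \<open>{x}\<close> tells the two kinds apart: a grown block contains
    \<open>x\<close> together with an element of the nonempty \<open>B\<close>, and the other blocks
    do not contain \<open>x\<close>.\<close>
  have disj: "insert {x} ` ?F \<inter> grow ` Sigma ?E (\<lambda>P. P) = {}"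
  proof -
    have "{x} \<notin> grow (P, B)" if "partition_on A P" "B \<in> P" for P B
    proof -
      have "B \<noteq> {}"
        using that by (auto simp: partition_on_def)
      then show ?thesis
        using x_notin[OF that] x_notin[OF that(1)] by (auto simp: grow_def)
    qed
    then have "{x} \<notin> Q" if "Q \<in> grow ` Sigma ?E (\<lambda>P. P)" for Q
      using that by (elim imageE SigmaE) simp
    then show ?thesis by blast
  qed
  have finE': "finite (Sigma ?E (\<lambda>P. P))"
    using finE fin by auto
  have "card ?S = card ?F + card (Sigma ?E (\<lambda>P. P))"
    unfolding S using finF finE' disj inj1 inj2
    by (subst card_Un_disjoint) (simp_all add: card_image)
  also have "card (Sigma ?E (\<lambda>P. P)) = Suc k * card ?E"
    using finE fin by (subst card_SigmaI) simp_all
  finally show ?thesis by simp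
qed

lemma card_partition_on_eq_Stirling:
  assumes "finite A"
  shows "card {P. partition_on A P \<and> card P = k} = Stirling (card A) k"
  using assms
proof (induction A arbitrary: k rule: finite_induct)
  case empty
  have "{P. partition_on ({} :: 'a set) P \<and> card P = k} = (if k = 0 then {{}} else {})"
    by (auto simp: partition_on_empty)
  then show ?case
    by (simp only:) (cases k; simp)
next
  case (insert x A)
  show ?case
  proof (cases k)
    case 0
    \<comment> \<open>A partition of a nonempty set has at least one block, which matches the value
      0 of \<open>Stirling\<close> at a successor and 0.\<close>
    have "card Q \<noteq> 0" if "partition_on (insert x A) Q" for Q
      using finite_elements[OF _ that] insert.hyps that by (auto simp: partition_on_def)
    then show ?thesis
      using 0 insert.hyps by (auto simp: card_eq_0_iff)
  next
    case (Suc j)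
    then show ?thesis
      using insert by (simp add: card_partition_on_insert)
  qed
qed

section \<open>Words beginning with the hat\<close>

lemma length_eq_count_letters:
  "length \<tau> = count_list \<tau> Zero + count_list \<tau> One + count_list \<tau> Hat"
proof (induction \<tau>)
  case (Cons c \<tau>)
  then show ?case by (cases c) auto
qed simp

text \<open>The three letter counts add up to the length, which fixes the number of
  \<open>Zero\<close>s as \<open>L - n - 1\<close>.\<close>

lemma Omega_iff:
  "\<tau> \<in> Omega L n \<longleftrightarrow> length \<tau> = L \<and> count_list \<tau> Hat = 1 \<and> count_list \<tau> One = n"
  using length_eq_count_letters[of \<tau>] by (auto simp: Omega_def)

lemma finite_Omega: "finite (Omega L n)"
proof (rule finite_subset)
  show "finite {\<tau>. set \<tau> \<subseteq> {Zero, One, Hat} \<and> length \<tau> = L}"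
    by (intro finite_lists_length_eq) simp
  have "c \<in> {Zero, One, Hat}" for c
    by (cases c) simp_all
  then show "Omega L n \<subseteq> {\<tau>. set \<tau> \<subseteq> {Zero, One, Hat} \<and> length \<tau> = L}"
    unfolding Omega_iff subset_iff by simp
qed

text \<open>The only hat sits at position 0, which for \<open>L \<ge> 1\<close> is not the last
  position, so the last letter is \<open>Zero\<close> or \<open>One\<close>. The guard
  \<open>n > 0\<close> keeps \<open>n - 1\<close> from truncating to 0 when there is no
  \<open>One\<close> to remove.\<close>

lemma Omega_Hat_Suc:
  assumes "L \<ge> 1"
  shows "{\<tau> \<in> Omega (Suc L) n. \<tau> ! 0 = Hat} =
    (\<lambda>\<tau>. \<tau> @ [Zero]) ` {\<tau> \<in> Omega L n. \<tau> ! 0 = Hat} \<union>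
    (\<lambda>\<tau>. \<tau> @ [One]) ` {\<tau>. n > 0 \<and> \<tau> \<in> Omega L (n - 1) \<and> \<tau> ! 0 = Hat}"
    (is "?A = ?B")
proof (intro equalityI subsetI)
  fix \<tau> assume "\<tau> \<in> ?A"
  then have \<tau>: "length \<tau> = Suc L" "count_list \<tau> Hat = 1" "count_list \<tau> One = n" "\<tau> ! 0 = Hat"
    by (auto simp: Omega_iff)
  then obtain \<sigma> c where \<sigma>: "\<tau> = \<sigma> @ [c]"
    by (metis append_butlast_last_id length_0_conv nat.distinct(1))
  then have hd: "\<sigma> ! 0 = Hat" and len: "length \<sigma> = L"
    using \<tau> assms by (auto simp: nth_append)
  \<comment> \<open>The single hat is already used up in \<open>\<sigma>\<close>, which rules out
    \<open>c = Hat\<close> in the final case split.\<close>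
  then have "Hat \<in> set \<sigma>"
    using assms by (metis nth_mem less_le_trans zero_less_one)
  then have "count_list \<sigma> Hat \<noteq> 0"
    by (simp add: count_list_0_iff)
  then show "\<tau> \<in> ?B"
    using \<sigma> \<tau> hd len by (cases c) (auto simp: Omega_iff image_iff)
qed (use assms in \<open>auto simp: Omega_iff nth_append\<close>)

section \<open>Effect of an appended letter on the weight\<close>

lemma ones_before_snoc:
  assumes "i \<le> length \<tau>"
  shows "ones_before (\<tau> @ [c]) i = ones_before \<tau> i"
  unfolding ones_before_def using assms
  by (intro arg_cong[where f = card]) (auto simp: nth_append)

text \<open>Counting in \<open>ones_before\<close> starts at position 1, so it agrees with the count
  over the whole word as soon as position 0 carries no \<open>One\<close>.\<close>

lemma ones_before_length:
  assumes "\<tau> ! 0 \<noteq> One"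
  shows "ones_before \<tau> (length \<tau>) = count_list \<tau> One"
proof -
  have "{j \<in> {1..<length \<tau>}. \<tau> ! j = One} = {j. j < length \<tau> \<and> One = \<tau> ! j}"
    using assms by (auto simp: Suc_le_eq intro: gr0I)
  then show ?thesis
    by (simp add: ones_before_def count_list_eq_length_filter length_filter_conv_card)
qed

lemma weight_snoc_One:
  "weight p 0 (\<tau> @ [One]) = weight p 0 \<tau>"
  unfolding weight_def
  by (rule prod.cong) (auto simp: nth_append ones_before_snoc less_Suc_eq)

text \<open>The appended \<open>Zero\<close> stands at index \<open>length \<tau>\<close>, after
  every \<open>One\<close> of \<open>\<tau>\<close>; this gives the new factor. With
  \<open>q = 0\<close> the old factors depend only on earlier letters.\<close>

lemma weight_snoc_Zero:
  assumes "length \<tau> \<ge> 1" "\<tau> ! 0 \<noteq> One"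
  shows "weight p 0 (\<tau> @ [Zero]) = (1 + p * of_nat (count_list \<tau> One)) * weight p 0 \<tau>"
proof -
  have "{i \<in> {1..<length (\<tau> @ [Zero])}. (\<tau> @ [Zero]) ! i = Zero} =
      insert (length \<tau>) {i \<in> {1..<length \<tau>}. \<tau> ! i = Zero}"
    using assms by (auto simp: nth_append)
  moreover have "(\<Prod>i \<in> {i \<in> {1..<length \<tau>}. \<tau> ! i = Zero}. 1 + p * of_nat (ones_before (\<tau> @ [Zero]) i))
      = (\<Prod>i \<in> {i \<in> {1..<length \<tau>}. \<tau> ! i = Zero}. 1 + p * of_nat (ones_before \<tau> i))"
    by (rule prod.cong) (auto simp: ones_before_snoc)
  ultimately show ?thesis
    using assms by (simp add: weight_def ones_before_snoc ones_before_length)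
qed

section \<open>Recurrence for the partition function and comparison with Stirling numbers\<close>

lemma restricted_partition_function_Suc:
  assumes "L \<ge> 1"
  shows "restricted_partition_function p 0 (Suc L) n =
    (1 + p * of_nat n) * restricted_partition_function p 0 L n +
    (if n = 0 then 0 else restricted_partition_function p 0 L (n - 1))"
proof -
  let ?A = "{\<tau> \<in> Omega L n. \<tau> ! 0 = Hat}"
  let ?B = "{\<tau>. n > 0 \<and> \<tau> \<in> Omega L (n - 1) \<and> \<tau> ! 0 = Hat}"
  have fin: "finite ?A" "finite ?B"
    using finite_Omega by (auto intro: finite_subset)
  have "restricted_partition_function p 0 (Suc L) n =
      (\<Sum>\<tau> \<in> ?A. weight p 0 (\<tau> @ [Zero])) + (\<Sum>\<tau> \<in> ?B. weight p 0 (\<tau> @ [One]))"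
    unfolding restricted_partition_function_def Omega_Hat_Suc[OF assms] using fin
    by (subst sum.union_disjoint) (auto simp: sum.reindex inj_on_def)
  also have "(\<Sum>\<tau> \<in> ?A. weight p 0 (\<tau> @ [Zero])) =
      (1 + p * of_nat n) * restricted_partition_function p 0 L n"
    unfolding restricted_partition_function_def sum_distrib_left
    using assms by (intro sum.cong) (auto simp: weight_snoc_Zero Omega_iff)
  also have "(\<Sum>\<tau> \<in> ?B. weight p 0 (\<tau> @ [One])) =
      (if n = 0 then 0 else restricted_partition_function p 0 L (n - 1))"
    by (simp add: weight_snoc_One restricted_partition_function_def)
  finally show ?thesis .
qed

lemma restricted_partition_function_1:
  "restricted_partition_function p q 1 n = (if n = 0 then 1 else 0)"
proof -
  have "{\<tau> \<in> Omega 1 n. \<tau> ! 0 = Hat} = (if n = 0 then {[Hat]} else {})"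
    by (auto simp: Omega_iff length_Suc_conv)
  moreover have no_zeros: "{i \<in> {1..<length [Hat]}. [Hat] ! i = Zero} = {}"
    by auto
  have "weight p q [Hat] = 1"
    unfolding weight_def no_zeros by simp
  ultimately show ?thesis
    by (simp add: restricted_partition_function_def)
qed

lemma restricted_partition_function_eq_Stirling:
  assumes "L \<ge> 1"
  shows "restricted_partition_function 1 0 L n = of_nat (Stirling L (Suc n))"
  using assms
proof (induction L arbitrary: n rule: nat_induct_at_least)
  case base
  then show ?case
    using restricted_partition_function_1[of 1 0 n] by (cases n) simp_all
next
  case (Suc L)
  \<comment> \<open>Exposing the successor makes \<open>Stirling L 0\<close> evaluate to 0, which
    for \<open>n = 0\<close> matches the 0 in the recurrence.\<close>
  obtain m where "L = Suc m"
    using Suc.hyps by (cases L) auto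
  then show ?case
    using Suc by (cases n) (simp_all add: restricted_partition_function_Suc algebra_simps)
qed

theorem corollary2p6:
  fixes L n :: nat
  assumes "L \<ge> 1" and "n \<le> L - 1"
  shows "restricted_partition_function (1::'a::comm_semiring_1) 0 L n = of_nat (stirling2 L (n + 1))"
  \<comment> \<open>The weighted sum and the count of set partitions meet at the recursively defined
    \<open>Stirling\<close>, with \<open>{1..L}\<close> as the set of size \<open>L\<close>.\<close>
  using restricted_partition_function_eq_Stirling[OF assms(1)]
    card_partition_on_eq_Stirling[of "{1..L}" "n + 1"]
  by (simp add: stirling2_def)

end
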